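(* Let $T$ be a relative pseudomonad over a pseudofunctor $J\colon\mathcal{C}\to\mathcal{D}$ between bicategories. Then there is a bicategory $\mathrm{Kl}(T)$, called the Kleisli bicategory of $T$, having the objects of $\mathcal{C}$ as objects, and hom-categories given by $\mathrm{Kl}(T)[X,Y]=\mathcal{D}[JX,TY]$, for $X,Y\in\mathcal{C}$.
   Context: Associativity and unit isomorphisms of bicategories are suppressed; "$\cdot$" is vertical composition of 2-cells, juxtaposition is composition of morphisms and whiskering. Relative pseudomonad. A relative pseudomonad $T$ over $J\colon\mathcal{C}\to\mathcal{D}$ consists of: an object $TX\in\mathcal{D}$ for each $X\in\mathcal{C}$; functors $(-)^*\colon\mathcal{D}[JX,TY]\to\mathcal{D}[TX,TY]$ for $X,Y\in\mathcal{C}$; morphisms $i_X\colon JX\to TX$; invertible 2-cells $\mu_{g,f}\colon(g^*f)^*\to g^*f^*$, natural in $f\colon JX\to TY$, $g\colon JY\to TZ$; invertible 2-cells $\eta_f\colon f\to f^*i_X$, natural in $f\colon JX\to TY$; invertible 2-cells $\theta_X\colon (i_X)^*\to 1_{TX}$; such that (associativity) for $f\colon JX\to TY$, $g\colon JY\to TZ$, $h\colon JZ\to TV$: $(h^*\mu_{g,f})\cdot\mu_{h,g^*f}\cdot(\mu_{h,g}f)^*=(\mu_{h,g}f^* )\cdot\mu_{h^*g,f}$ as 2-cells $((h^*g)^*f)^*\to h^*g^*f^*$; (unit) for $f\colon JX\to TY$: $(f^*\theta_X)\cdot\mu_{f,i_X}\cdot(\eta_f)^*=1_{f^*}$. *)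

theory Defs
  imports Main
begin

record ('o, 'a) cat =
  Ob :: "'o set"
  Arr :: "'a set"
  Dom :: "'a \<Rightarrow> 'o"
  Cod :: "'a \<Rightarrow> 'o"
  Id :: "'o \<Rightarrow> 'a"
  Comp :: "'a \<Rightarrow> 'a \<Rightarrow> 'a"  \<comment> \<open>\<open>Comp A q p\<close> is \<open>q\<close> after \<open>p\<close>\<close>

definition arrs :: "('o, 'a) cat \<Rightarrow> 'o \<Rightarrow> 'o \<Rightarrow> 'a set" where
  "arrs A x y = {p \<in> Arr A. Dom A p = x \<and> Cod A p = y}"

locale category =
  fixes A :: "('o, 'a) cat"
  assumes dom_ob: "p \<in> Arr A \<Longrightarrow> Dom A p \<in> Ob A"
    and cod_ob: "p \<in> Arr A \<Longrightarrow> Cod A p \<in> Ob A"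
    and id_arr: "x \<in> Ob A \<Longrightarrow> Id A x \<in> arrs A x x"
    and comp_arr: "\<lbrakk>p \<in> arrs A x y; q \<in> arrs A y z\<rbrakk> \<Longrightarrow> Comp A q p \<in> arrs A x z"
    and comp_id: "p \<in> arrs A x y \<Longrightarrow> Comp A p (Id A x) = p"
    and id_comp: "p \<in> arrs A x y \<Longrightarrow> Comp A (Id A y) p = p"
    and comp_assoc: "\<lbrakk>p \<in> arrs A w x; q \<in> arrs A x y; r \<in> arrs A y z\<rbrakk> \<Longrightarrow>
      Comp A r (Comp A q p) = Comp A (Comp A r q) p"

definition isos :: "('o, 'a) cat \<Rightarrow> 'o \<Rightarrow> 'o \<Rightarrow> 'a set" where
  "isos A x y = {p \<in> arrs A x y. \<exists>q \<in> arrs A y x. Comp A q p = Id A x \<and> Comp A p q = Id A y}"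

definition prod_cat :: "('o, 'a) cat \<Rightarrow> ('p, 'b) cat \<Rightarrow> ('o \<times> 'p, 'a \<times> 'b) cat" where
  "prod_cat A B = \<lparr>Ob = Ob A \<times> Ob B, Arr = Arr A \<times> Arr B,
     Dom = map_prod (Dom A) (Dom B), Cod = map_prod (Cod A) (Cod B),
     Id = map_prod (Id A) (Id B),
     Comp = (\<lambda>(q, q') (p, p'). (Comp A q p, Comp B q' p'))\<rparr>"

definition is_functor ::
  "('o, 'a) cat \<Rightarrow> ('p, 'b) cat \<Rightarrow> ('o \<Rightarrow> 'p) \<Rightarrow> ('a \<Rightarrow> 'b) \<Rightarrow> bool" where
  "is_functor A B F0 F1 \<longleftrightarrow> category A \<and> category B \<and>
     (\<forall>x\<in>Ob A. F0 x \<in> Ob B) \<and>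
     (\<forall>x\<in>Ob A. \<forall>y\<in>Ob A. \<forall>p\<in>arrs A x y. F1 p \<in> arrs B (F0 x) (F0 y)) \<and>
     (\<forall>x\<in>Ob A. F1 (Id A x) = Id B (F0 x)) \<and>
     (\<forall>x\<in>Ob A. \<forall>y\<in>Ob A. \<forall>z\<in>Ob A. \<forall>p\<in>arrs A x y. \<forall>q\<in>arrs A y z.
        F1 (Comp A q p) = Comp B (F1 q) (F1 p))"

text \<open>
  Different hom-categories need not be disjoint, so a 1-cell does not determine its source and
  target, and all operations carry the objects involved. For \<open>f : X \<rightarrow> Y\<close>,
  \<open>g : Y \<rightarrow> Z\<close>, \<open>h : Z \<rightarrow> W\<close>:
  \<open>HComp1 B X Y Z g f\<close> is the composite \<open>g f : X \<rightarrow> Z\<close>, \<open>HComp2 B X Y Z\<close> is the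
  horizontal composition of 2-cells, and
  \<open>Assoc B X Y Z W h g f : (h g) f \<rightarrow> h (g f)\<close>,
  \<open>LUnit B X Y f : 1 f \<rightarrow> f\<close>, \<open>RUnit B X Y f : f 1 \<rightarrow> f\<close>.
\<close>

record ('o, 'm, 'c) bicat =
  Obj :: "'o set"
  Hom :: "'o \<Rightarrow> 'o \<Rightarrow> ('m, 'c) cat"
  One :: "'o \<Rightarrow> 'm"
  HComp1 :: "'o \<Rightarrow> 'o \<Rightarrow> 'o \<Rightarrow> 'm \<Rightarrow> 'm \<Rightarrow> 'm"
  HComp2 :: "'o \<Rightarrow> 'o \<Rightarrow> 'o \<Rightarrow> 'c \<Rightarrow> 'c \<Rightarrow> 'c"
  Assoc :: "'o \<Rightarrow> 'o \<Rightarrow> 'o \<Rightarrow> 'o \<Rightarrow> 'm \<Rightarrow> 'm \<Rightarrow> 'm \<Rightarrow> 'c"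
  LUnit :: "'o \<Rightarrow> 'o \<Rightarrow> 'm \<Rightarrow> 'c"
  RUnit :: "'o \<Rightarrow> 'o \<Rightarrow> 'm \<Rightarrow> 'c"

abbreviation Mor :: "('o, 'm, 'c) bicat \<Rightarrow> 'o \<Rightarrow> 'o \<Rightarrow> 'm set" where
  "Mor B X Y \<equiv> Ob (Hom B X Y)"

abbreviation Cells :: "('o, 'm, 'c) bicat \<Rightarrow> 'o \<Rightarrow> 'o \<Rightarrow> 'm \<Rightarrow> 'm \<Rightarrow> 'c set" where
  "Cells B X Y \<equiv> arrs (Hom B X Y)"

abbreviation ICells :: "('o, 'm, 'c) bicat \<Rightarrow> 'o \<Rightarrow> 'o \<Rightarrow> 'm \<Rightarrow> 'm \<Rightarrow> 'c set" where
  "ICells B X Y \<equiv> isos (Hom B X Y)"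

abbreviation VComp :: "('o, 'm, 'c) bicat \<Rightarrow> 'o \<Rightarrow> 'o \<Rightarrow> 'c \<Rightarrow> 'c \<Rightarrow> 'c" where
  "VComp B X Y \<equiv> Comp (Hom B X Y)"

abbreviation LWhisk :: "('o, 'm, 'c) bicat \<Rightarrow> 'o \<Rightarrow> 'o \<Rightarrow> 'o \<Rightarrow> 'm \<Rightarrow> 'c \<Rightarrow> 'c" where
  "LWhisk B X Y Z g p \<equiv> HComp2 B X Y Z (Id (Hom B Y Z) g) p"

abbreviation RWhisk :: "('o, 'm, 'c) bicat \<Rightarrow> 'o \<Rightarrow> 'o \<Rightarrow> 'o \<Rightarrow> 'c \<Rightarrow> 'm \<Rightarrow> 'c" where
  "RWhisk B X Y Z q f \<equiv> HComp2 B X Y Z q (Id (Hom B X Y) f)"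

locale bicategory =
  fixes B :: "('o, 'm, 'c) bicat"
  assumes hom_category:
      "\<lbrakk>X \<in> Obj B; Y \<in> Obj B\<rbrakk> \<Longrightarrow> category (Hom B X Y)"
    and one_mor:
      "X \<in> Obj B \<Longrightarrow> One B X \<in> Mor B X X"
    and hcomp_functor:
      "\<lbrakk>X \<in> Obj B; Y \<in> Obj B; Z \<in> Obj B\<rbrakk> \<Longrightarrow>
       is_functor (prod_cat (Hom B Y Z) (Hom B X Y)) (Hom B X Z)
         (\<lambda>(g, f). HComp1 B X Y Z g f) (\<lambda>(q, p). HComp2 B X Y Z q p)"
    and assoc_iso:
      "\<lbrakk>X \<in> Obj B; Y \<in> Obj B; Z \<in> Obj B; W \<in> Obj B;
        f \<in> Mor B X Y; g \<in> Mor B Y Z; h \<in> Mor B Z W\<rbrakk> \<Longrightarrow>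
       Assoc B X Y Z W h g f \<in>
         ICells B X W (HComp1 B X Y W (HComp1 B Y Z W h g) f)
                      (HComp1 B X Z W h (HComp1 B X Y Z g f))"
    and assoc_natural:
      "\<lbrakk>X \<in> Obj B; Y \<in> Obj B; Z \<in> Obj B; W \<in> Obj B;
        f \<in> Mor B X Y; f' \<in> Mor B X Y; g \<in> Mor B Y Z; g' \<in> Mor B Y Z;
        h \<in> Mor B Z W; h' \<in> Mor B Z W;
        p \<in> Cells B X Y f f'; q \<in> Cells B Y Z g g'; r \<in> Cells B Z W h h'\<rbrakk> \<Longrightarrow>
       VComp B X W (Assoc B X Y Z W h' g' f') (HComp2 B X Y W (HComp2 B Y Z W r q) p) =
       VComp B X W (HComp2 B X Z W r (HComp2 B X Y Z q p)) (Assoc B X Y Z W h g f)"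
    and lunit_iso:
      "\<lbrakk>X \<in> Obj B; Y \<in> Obj B; f \<in> Mor B X Y\<rbrakk> \<Longrightarrow>
       LUnit B X Y f \<in> ICells B X Y (HComp1 B X Y Y (One B Y) f) f"
    and lunit_natural:
      "\<lbrakk>X \<in> Obj B; Y \<in> Obj B; f \<in> Mor B X Y; f' \<in> Mor B X Y; p \<in> Cells B X Y f f'\<rbrakk> \<Longrightarrow>
       VComp B X Y (LUnit B X Y f') (LWhisk B X Y Y (One B Y) p) =
       VComp B X Y p (LUnit B X Y f)"
    and runit_iso:
      "\<lbrakk>X \<in> Obj B; Y \<in> Obj B; f \<in> Mor B X Y\<rbrakk> \<Longrightarrow>
       RUnit B X Y f \<in> ICells B X Y (HComp1 B X X Y f (One B X)) f"
    and runit_natural: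
      "\<lbrakk>X \<in> Obj B; Y \<in> Obj B; f \<in> Mor B X Y; f' \<in> Mor B X Y; p \<in> Cells B X Y f f'\<rbrakk> \<Longrightarrow>
       VComp B X Y (RUnit B X Y f') (RWhisk B X X Y p (One B X)) =
       VComp B X Y p (RUnit B X Y f)"
    and pentagon:
      "\<lbrakk>X \<in> Obj B; Y \<in> Obj B; Z \<in> Obj B; W \<in> Obj B; V \<in> Obj B;
        f \<in> Mor B X Y; g \<in> Mor B Y Z; h \<in> Mor B Z W; k \<in> Mor B W V\<rbrakk> \<Longrightarrow>
       VComp B X V (Assoc B X Z W V k h (HComp1 B X Y Z g f))
                   (Assoc B X Y Z V (HComp1 B Z W V k h) g f) =
       VComp B X V (LWhisk B X W V k (Assoc B X Y Z W h g f))
         (VComp B X V (Assoc B X Y W V k (HComp1 B Y Z W h g) f)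
                      (RWhisk B X Y V (Assoc B Y Z W V k h g) f))"
    and triangle:
      "\<lbrakk>X \<in> Obj B; Y \<in> Obj B; Z \<in> Obj B; f \<in> Mor B X Y; g \<in> Mor B Y Z\<rbrakk> \<Longrightarrow>
       VComp B X Z (LWhisk B X Y Z g (LUnit B X Y f)) (Assoc B X Y Y Z g (One B Y) f) =
       RWhisk B X Y Z (RUnit B Y Z g) f"

text \<open>
  The constraint cells are
  \<open>PfComp J X Y Z g f : J g J f \<rightarrow> J (g f)\<close> and \<open>PfUnit J X : 1 \<rightarrow> J 1\<close>.
\<close>

record ('o, 'm, 'c, 'p, 'n, 'd) pseudofun =
  PfObj :: "'o \<Rightarrow> 'p"
  PfMor :: "'o \<Rightarrow> 'o \<Rightarrow> 'm \<Rightarrow> 'n"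
  PfCell :: "'o \<Rightarrow> 'o \<Rightarrow> 'c \<Rightarrow> 'd"
  PfComp :: "'o \<Rightarrow> 'o \<Rightarrow> 'o \<Rightarrow> 'm \<Rightarrow> 'm \<Rightarrow> 'd"
  PfUnit :: "'o \<Rightarrow> 'd"

locale pseudofunctor = C: bicategory C + D: bicategory D
  for C :: "('o, 'm, 'c) bicat" and D :: "('p, 'n, 'd) bicat" +
  fixes J :: "('o, 'm, 'c, 'p, 'n, 'd) pseudofun"
  assumes pf_obj:
      "X \<in> Obj C \<Longrightarrow> PfObj J X \<in> Obj D"
    and pf_functor:
      "\<lbrakk>X \<in> Obj C; Y \<in> Obj C\<rbrakk> \<Longrightarrow>
       is_functor (Hom C X Y) (Hom D (PfObj J X) (PfObj J Y)) (PfMor J X Y) (PfCell J X Y)"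
    and pf_comp_iso:
      "\<lbrakk>X \<in> Obj C; Y \<in> Obj C; Z \<in> Obj C; f \<in> Mor C X Y; g \<in> Mor C Y Z\<rbrakk> \<Longrightarrow>
       PfComp J X Y Z g f \<in> ICells D (PfObj J X) (PfObj J Z)
         (HComp1 D (PfObj J X) (PfObj J Y) (PfObj J Z) (PfMor J Y Z g) (PfMor J X Y f))
         (PfMor J X Z (HComp1 C X Y Z g f))"
    and pf_comp_natural:
      "\<lbrakk>X \<in> Obj C; Y \<in> Obj C; Z \<in> Obj C;
        f \<in> Mor C X Y; f' \<in> Mor C X Y; g \<in> Mor C Y Z; g' \<in> Mor C Y Z;
        p \<in> Cells C X Y f f'; q \<in> Cells C Y Z g g'\<rbrakk> \<Longrightarrow>
       VComp D (PfObj J X) (PfObj J Z) (PfComp J X Y Z g' f')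
         (HComp2 D (PfObj J X) (PfObj J Y) (PfObj J Z) (PfCell J Y Z q) (PfCell J X Y p)) =
       VComp D (PfObj J X) (PfObj J Z)
         (PfCell J X Z (HComp2 C X Y Z q p)) (PfComp J X Y Z g f)"
    and pf_unit_iso:
      "X \<in> Obj C \<Longrightarrow>
       PfUnit J X \<in> ICells D (PfObj J X) (PfObj J X) (One D (PfObj J X)) (PfMor J X X (One C X))"
    and pf_assoc:
      "\<lbrakk>X \<in> Obj C; Y \<in> Obj C; Z \<in> Obj C; W \<in> Obj C;
        f \<in> Mor C X Y; g \<in> Mor C Y Z; h \<in> Mor C Z W\<rbrakk> \<Longrightarrow>
       VComp D (PfObj J X) (PfObj J W) (PfComp J X Z W h (HComp1 C X Y Z g f))
         (VComp D (PfObj J X) (PfObj J W)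
            (LWhisk D (PfObj J X) (PfObj J Z) (PfObj J W) (PfMor J Z W h) (PfComp J X Y Z g f))
            (Assoc D (PfObj J X) (PfObj J Y) (PfObj J Z) (PfObj J W)
               (PfMor J Z W h) (PfMor J Y Z g) (PfMor J X Y f))) =
       VComp D (PfObj J X) (PfObj J W) (PfCell J X W (Assoc C X Y Z W h g f))
         (VComp D (PfObj J X) (PfObj J W) (PfComp J X Y W (HComp1 C Y Z W h g) f)
            (RWhisk D (PfObj J X) (PfObj J Y) (PfObj J W) (PfComp J Y Z W h g) (PfMor J X Y f)))"
    and pf_lunit:
      "\<lbrakk>X \<in> Obj C; Y \<in> Obj C; f \<in> Mor C X Y\<rbrakk> \<Longrightarrow>
       VComp D (PfObj J X) (PfObj J Y) (PfCell J X Y (LUnit C X Y f))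
         (VComp D (PfObj J X) (PfObj J Y) (PfComp J X Y Y (One C Y) f)
            (RWhisk D (PfObj J X) (PfObj J Y) (PfObj J Y) (PfUnit J Y) (PfMor J X Y f))) =
       LUnit D (PfObj J X) (PfObj J Y) (PfMor J X Y f)"
    and pf_runit:
      "\<lbrakk>X \<in> Obj C; Y \<in> Obj C; f \<in> Mor C X Y\<rbrakk> \<Longrightarrow>
       VComp D (PfObj J X) (PfObj J Y) (PfCell J X Y (RUnit C X Y f))
         (VComp D (PfObj J X) (PfObj J Y) (PfComp J X X Y f (One C X))
            (LWhisk D (PfObj J X) (PfObj J X) (PfObj J Y) (PfMor J X Y f) (PfUnit J X))) =
       RUnit D (PfObj J X) (PfObj J Y) (PfMor J X Y f)"

text \<open>
  For \<open>f : J X \<rightarrow> T Y\<close>, \<open>g : J Y \<rightarrow> T Z\<close>: \<open>Ext1 T X Y f\<close> is \<open>f\<^sup>*\<close>, \<open>Ext2 T X Y\<close> is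
  the action of \<open>(-)\<^sup>*\<close> on 2-cells, \<open>I T X\<close> is \<open>i\<close>, \<open>Mu T X Y Z g f : (g\<^sup>* f)\<^sup>* \<rightarrow> g\<^sup>* f\<^sup>*\<close>,
  \<open>Eta T X Y f : f \<rightarrow> f\<^sup>* i\<close>, \<open>Theta T X : i\<^sup>* \<rightarrow> 1\<close>.
\<close>

record ('o, 'p, 'n, 'd) relpsmonad =
  TObj :: "'o \<Rightarrow> 'p"
  Ext1 :: "'o \<Rightarrow> 'o \<Rightarrow> 'n \<Rightarrow> 'n"
  Ext2 :: "'o \<Rightarrow> 'o \<Rightarrow> 'd \<Rightarrow> 'd"
  I :: "'o \<Rightarrow> 'n"
  Mu :: "'o \<Rightarrow> 'o \<Rightarrow> 'o \<Rightarrow> 'n \<Rightarrow> 'n \<Rightarrow> 'd"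
  Eta :: "'o \<Rightarrow> 'o \<Rightarrow> 'n \<Rightarrow> 'd"
  Theta :: "'o \<Rightarrow> 'd"

text \<open>
  The associator and right unitor of \<open>D\<close>, usually suppressed, appear explicitly in
  \<open>associativity\<close> (once inside \<open>(-)\<^sup>*\<close>) and \<open>unit\<close>.
\<close>

locale relative_pseudomonad = pseudofunctor C D J
  for C :: "('o, 'm, 'c) bicat" and D :: "('p, 'n, 'd) bicat"
    and J :: "('o, 'm, 'c, 'p, 'n, 'd) pseudofun" +
  fixes T :: "('o, 'p, 'n, 'd) relpsmonad"
  assumes t_obj:
      "X \<in> Obj C \<Longrightarrow> TObj T X \<in> Obj D"
    and ext_functor:
      "\<lbrakk>X \<in> Obj C; Y \<in> Obj C\<rbrakk> \<Longrightarrow>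
       is_functor (Hom D (PfObj J X) (TObj T Y)) (Hom D (TObj T X) (TObj T Y))
         (Ext1 T X Y) (Ext2 T X Y)"
    and i_mor:
      "X \<in> Obj C \<Longrightarrow> I T X \<in> Mor D (PfObj J X) (TObj T X)"
    and mu_iso:
      "\<lbrakk>X \<in> Obj C; Y \<in> Obj C; Z \<in> Obj C;
        f \<in> Mor D (PfObj J X) (TObj T Y); g \<in> Mor D (PfObj J Y) (TObj T Z)\<rbrakk> \<Longrightarrow>
       Mu T X Y Z g f \<in> ICells D (TObj T X) (TObj T Z)
         (Ext1 T X Z (HComp1 D (PfObj J X) (TObj T Y) (TObj T Z) (Ext1 T Y Z g) f))
         (HComp1 D (TObj T X) (TObj T Y) (TObj T Z) (Ext1 T Y Z g) (Ext1 T X Y f))"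
    and mu_natural:
      "\<lbrakk>X \<in> Obj C; Y \<in> Obj C; Z \<in> Obj C;
        f \<in> Mor D (PfObj J X) (TObj T Y); f' \<in> Mor D (PfObj J X) (TObj T Y);
        g \<in> Mor D (PfObj J Y) (TObj T Z); g' \<in> Mor D (PfObj J Y) (TObj T Z);
        p \<in> Cells D (PfObj J X) (TObj T Y) f f'; q \<in> Cells D (PfObj J Y) (TObj T Z) g g'\<rbrakk> \<Longrightarrow>
       VComp D (TObj T X) (TObj T Z) (Mu T X Y Z g' f')
         (Ext2 T X Z (HComp2 D (PfObj J X) (TObj T Y) (TObj T Z) (Ext2 T Y Z q) p)) =
       VComp D (TObj T X) (TObj T Z)
         (HComp2 D (TObj T X) (TObj T Y) (TObj T Z) (Ext2 T Y Z q) (Ext2 T X Y p))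
         (Mu T X Y Z g f)"
    and eta_iso:
      "\<lbrakk>X \<in> Obj C; Y \<in> Obj C; f \<in> Mor D (PfObj J X) (TObj T Y)\<rbrakk> \<Longrightarrow>
       Eta T X Y f \<in> ICells D (PfObj J X) (TObj T Y)
         f (HComp1 D (PfObj J X) (TObj T X) (TObj T Y) (Ext1 T X Y f) (I T X))"
    and eta_natural:
      "\<lbrakk>X \<in> Obj C; Y \<in> Obj C;
        f \<in> Mor D (PfObj J X) (TObj T Y); f' \<in> Mor D (PfObj J X) (TObj T Y);
        p \<in> Cells D (PfObj J X) (TObj T Y) f f'\<rbrakk> \<Longrightarrow>
       VComp D (PfObj J X) (TObj T Y) (Eta T X Y f') p =
       VComp D (PfObj J X) (TObj T Y)
         (RWhisk D (PfObj J X) (TObj T X) (TObj T Y) (Ext2 T X Y p) (I T X)) (Eta T X Y f)"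
    and theta_iso:
      "X \<in> Obj C \<Longrightarrow>
       Theta T X \<in> ICells D (TObj T X) (TObj T X) (Ext1 T X X (I T X)) (One D (TObj T X))"
    and associativity:
      "\<lbrakk>X \<in> Obj C; Y \<in> Obj C; Z \<in> Obj C; V \<in> Obj C;
        f \<in> Mor D (PfObj J X) (TObj T Y); g \<in> Mor D (PfObj J Y) (TObj T Z);
        h \<in> Mor D (PfObj J Z) (TObj T V)\<rbrakk> \<Longrightarrow>
       VComp D (TObj T X) (TObj T V)
         (LWhisk D (TObj T X) (TObj T Z) (TObj T V) (Ext1 T Z V h) (Mu T X Y Z g f))
         (VComp D (TObj T X) (TObj T V)
            (Mu T X Z V h (HComp1 D (PfObj J X) (TObj T Y) (TObj T Z) (Ext1 T Y Z g) f))
            (VComp D (TObj T X) (TObj T V)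
               (Ext2 T X V (Assoc D (PfObj J X) (TObj T Y) (TObj T Z) (TObj T V)
                  (Ext1 T Z V h) (Ext1 T Y Z g) f))
               (Ext2 T X V
                  (RWhisk D (PfObj J X) (TObj T Y) (TObj T V) (Mu T Y Z V h g) f)))) =
       VComp D (TObj T X) (TObj T V)
         (Assoc D (TObj T X) (TObj T Y) (TObj T Z) (TObj T V)
            (Ext1 T Z V h) (Ext1 T Y Z g) (Ext1 T X Y f))
         (VComp D (TObj T X) (TObj T V)
            (RWhisk D (TObj T X) (TObj T Y) (TObj T V) (Mu T Y Z V h g) (Ext1 T X Y f))
            (Mu T X Y V (HComp1 D (PfObj J Y) (TObj T Z) (TObj T V) (Ext1 T Z V h) g) f))"
    and unit:
      "\<lbrakk>X \<in> Obj C; Y \<in> Obj C; f \<in> Mor D (PfObj J X) (TObj T Y)\<rbrakk> \<Longrightarrow>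
       VComp D (TObj T X) (TObj T Y) (RUnit D (TObj T X) (TObj T Y) (Ext1 T X Y f))
         (VComp D (TObj T X) (TObj T Y)
            (LWhisk D (TObj T X) (TObj T X) (TObj T Y) (Ext1 T X Y f) (Theta T X))
            (VComp D (TObj T X) (TObj T Y)
               (Mu T X X Y f (I T X))
               (Ext2 T X Y (Eta T X Y f)))) =
       Id (Hom D (TObj T X) (TObj T Y)) (Ext1 T X Y f)"

end

theory Submission
  imports Defs
begin

text \<open>
  Whiskering the associativity axiom with a further 1-cell \<open>f\<close> reduces the Kleisli pentagon to
  the pentagon of \<open>D\<close>. The right unitor being \<open>\<eta>\<close> inverted, the unit axiom computes its image
  under \<open>(-)\<^sup>*\<close>, and whiskering this with \<open>f\<close> reduces the Kleisli triangle to the triangle of \<open>D\<close>.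
\<close>

section \<open>Categories and functors\<close>

context category
begin

lemma arr_id:
  assumes "x \<in> Ob A"
  shows "Id A x \<in> Arr A" "Dom A (Id A x) = x" "Cod A (Id A x) = x"
  using id_arr[OF assms] by (auto simp: arrs_def)

lemma arr_comp:
  assumes "p \<in> Arr A" "q \<in> Arr A" "Cod A p = Dom A q"
  shows "Comp A q p \<in> Arr A" "Dom A (Comp A q p) = Dom A p" "Cod A (Comp A q p) = Cod A q"
  using comp_arr[of p "Dom A p" "Cod A p" q "Cod A q"] assms by (auto simp: arrs_def)

lemma comp_Id: "p \<in> Arr A \<Longrightarrow> Dom A p = x \<Longrightarrow> Comp A p (Id A x) = p"
  by (rule comp_id) (auto simp: arrs_def)

lemma Id_comp: "p \<in> Arr A \<Longrightarrow> Cod A p = y \<Longrightarrow> Comp A (Id A y) p = p"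
  by (rule id_comp) (auto simp: arrs_def)

text \<open>Oriented against \<open>comp_assoc\<close>, with typing read off \<open>Dom\<close> and
  \<open>Cod\<close>: as a rewrite rule it nests composites to the right. Every later step that only
  moves brackets uses it.\<close>

lemma comp_comp:
  assumes "p \<in> Arr A" "q \<in> Arr A" "r \<in> Arr A" "Cod A p = Dom A q" "Cod A q = Dom A r"
  shows "Comp A (Comp A r q) p = Comp A r (Comp A q p)"
  by (rule comp_assoc[symmetric]) (use assms in \<open>auto simp: arrs_def\<close>)

lemma arrs_ob: "p \<in> arrs A x y \<Longrightarrow> x \<in> Ob A \<and> y \<in> Ob A"
  using dom_ob cod_ob by (auto simp: arrs_def)

lemma id_iso: "x \<in> Ob A \<Longrightarrow> Id A x \<in> isos A x x"
  using id_arr comp_id by (auto simp: isos_def intro!: bexI[of _ "Id A x"])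

lemma comp_iso:
  assumes "p \<in> isos A x y" "q \<in> isos A y z"
  shows "Comp A q p \<in> isos A x z"
proof -
  obtain p' where p: "p \<in> arrs A x y" "p' \<in> arrs A y x" "Comp A p' p = Id A x" "Comp A p p' = Id A y"
    using assms(1) by (auto simp: isos_def)
  obtain q' where q: "q \<in> arrs A y z" "q' \<in> arrs A z y" "Comp A q' q = Id A y" "Comp A q q' = Id A z"
    using assms(2) by (auto simp: isos_def)
  \<comment> \<open>The inverse is the composite of the inverses in reverse order; rebracketing
    brings a cancelling pair to the middle.\<close>
  have "Comp A (Comp A p' q') (Comp A q p) = Comp A p' (Comp A (Comp A q' q) p)"
    using p(1,2) q(1,2) by (simp add: comp_comp arr_comp arrs_def)
  moreover have "Comp A (Comp A q p) (Comp A p' q') = Comp A q (Comp A (Comp A p p') q')"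
    using p(1,2) q(1,2) by (simp add: comp_comp arr_comp arrs_def)
  ultimately show ?thesis
    using p q comp_arr[of p x y q z] comp_arr[of q' z y p' x]
    by (auto simp: isos_def id_comp intro!: bexI[of _ "Comp A p' q'"])
qed

end

text \<open>\<open>isos\<close> only asserts that an inverse exists, while the Kleisli right unitor
  must be an actual cell. Inverses in a category are unique, so the choice is harmless.\<close>

definition inv_arr :: "('o, 'a) cat \<Rightarrow> 'o \<Rightarrow> 'o \<Rightarrow> 'a \<Rightarrow> 'a" where
  "inv_arr A x y p = (SOME q. q \<in> arrs A y x \<and> Comp A q p = Id A x \<and> Comp A p q = Id A y)"

lemma inv_arr:
  assumes "p \<in> isos A x y"
  shows "inv_arr A x y p \<in> arrs A y x" "Comp A (inv_arr A x y p) p = Id A x"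
    "Comp A p (inv_arr A x y p) = Id A y"
proof -
  have "\<exists>q. q \<in> arrs A y x \<and> Comp A q p = Id A x \<and> Comp A p q = Id A y"
    using assms by (auto simp: isos_def)
  from someI_ex[OF this] show "inv_arr A x y p \<in> arrs A y x"
    "Comp A (inv_arr A x y p) p = Id A x" "Comp A p (inv_arr A x y p) = Id A y"
    by (auto simp: inv_arr_def)
qed

lemma inv_arr_iso: "p \<in> isos A x y \<Longrightarrow> inv_arr A x y p \<in> isos A y x"
  using inv_arr[of p A x y] by (auto simp: isos_def)

section \<open>Product categories\<close>

lemma prod_cat_simps [simp]:
  "Ob (prod_cat A B) = Ob A \<times> Ob B"
  "Arr (prod_cat A B) = Arr A \<times> Arr B"
  "Dom (prod_cat A B) = map_prod (Dom A) (Dom B)"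
  "Cod (prod_cat A B) = map_prod (Cod A) (Cod B)"
  "Id (prod_cat A B) = map_prod (Id A) (Id B)"
  "Comp (prod_cat A B) (q, q') (p, p') = (Comp A q p, Comp B q' p')"
  by (simp_all add: prod_cat_def)

lemma arrs_prod_cat [simp]:
  "(q, p) \<in> arrs (prod_cat A B) (x, w) (y, z) \<longleftrightarrow> q \<in> arrs A x y \<and> p \<in> arrs B w z"
  by (auto simp: arrs_def)

lemma isos_prod_cat:
  assumes "q \<in> isos A x y" "p \<in> isos B w z"
  shows "(q, p) \<in> isos (prod_cat A B) (x, w) (y, z)"
proof -
  obtain q' p' where "q' \<in> arrs A y x" "Comp A q' q = Id A x" "Comp A q q' = Id A y"
    "p' \<in> arrs B z w" "Comp B p' p = Id B w" "Comp B p p' = Id B z"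
    using assms by (auto simp: isos_def)
  then show ?thesis
    using assms by (auto simp: isos_def intro!: bexI[of _ "(q', p')"])
qed

lemma category_prod_cat:
  assumes "category A" "category B"
  shows "category (prod_cat A B)"
proof -
  interpret A: category A by fact
  interpret B: category B by fact
  show ?thesis
    by unfold_locales
      (auto simp: A.dom_ob A.cod_ob B.dom_ob B.cod_ob A.id_arr B.id_arr A.comp_id B.comp_id
        A.id_comp B.id_comp A.comp_assoc B.comp_assoc intro: A.comp_arr B.comp_arr)
qed

section \<open>Functors\<close>

lemma is_functorI:
  assumes "category A" "category B"
    and "\<And>x. x \<in> Ob A \<Longrightarrow> F0 x \<in> Ob B"
    and "\<And>x y p. p \<in> arrs A x y \<Longrightarrow> F1 p \<in> arrs B (F0 x) (F0 y)"
    and "\<And>x. x \<in> Ob A \<Longrightarrow> F1 (Id A x) = Id B (F0 x)"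
    and "\<And>x y z p q. p \<in> arrs A x y \<Longrightarrow> q \<in> arrs A y z \<Longrightarrow>
      F1 (Comp A q p) = Comp B (F1 q) (F1 p)"
  shows "is_functor A B F0 F1"
  using assms unfolding is_functor_def by blast

lemma is_functorD:
  assumes "is_functor A B F0 F1"
  shows "category A" "category B"
    and "x \<in> Ob A \<Longrightarrow> F0 x \<in> Ob B"
    and "p \<in> arrs A x y \<Longrightarrow> F1 p \<in> arrs B (F0 x) (F0 y)"
    and "x \<in> Ob A \<Longrightarrow> F1 (Id A x) = Id B (F0 x)"
    and "p \<in> arrs A x y \<Longrightarrow> q \<in> arrs A y z \<Longrightarrow> F1 (Comp A q p) = Comp B (F1 q) (F1 p)"
  using assms category.arrs_ob[of A] unfolding is_functor_def by blast+

lemma is_functor_id: "category A \<Longrightarrow> is_functor A A id id"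
  by (rule is_functorI) auto

lemma is_functor_comp:
  assumes F: "is_functor A B F0 F1" and G: "is_functor B C G0 G1"
  shows "is_functor A C (G0 \<circ> F0) (G1 \<circ> F1)"
  by (rule is_functorI) (auto simp: is_functorD[OF F] is_functorD[OF G]
      is_functorD(6)[OF F] is_functorD(6)[OF G is_functorD(4)[OF F] is_functorD(4)[OF F]])

lemma is_functor_map_prod:
  assumes F: "is_functor A A' F0 F1" and G: "is_functor B B' G0 G1"
  shows "is_functor (prod_cat A B) (prod_cat A' B') (map_prod F0 G0) (map_prod F1 G1)"
proof (rule is_functorI)
  show "category (prod_cat A B)" "category (prod_cat A' B')"
    using is_functorD(1,2)[OF F] is_functorD(1,2)[OF G] by (auto intro: category_prod_cat)
qed (auto simp: is_functorD[OF F] is_functorD[OF G] intro: is_functorD(6)[OF F] is_functorD(6)[OF G])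

lemma is_functor_iso:
  assumes F: "is_functor A B F0 F1" and p: "p \<in> isos A x y"
  shows "F1 p \<in> isos B (F0 x) (F0 y)"
proof -
  obtain q where q: "p \<in> arrs A x y" "q \<in> arrs A y x" "Comp A q p = Id A x" "Comp A p q = Id A y"
    using p by (auto simp: isos_def)
  then have "x \<in> Ob A" "y \<in> Ob A"
    using category.arrs_ob[OF is_functorD(1)[OF F]] by blast+
  with q show ?thesis
    using is_functorD(4)[OF F q(1)] is_functorD(4)[OF F q(2)] is_functorD(5)[OF F]
      is_functorD(6)[OF F q(1,2)] is_functorD(6)[OF F q(2,1)]
    by (auto simp: isos_def intro!: bexI[of _ "F1 q"])
qed

section \<open>Calculating in a bicategory\<close>

text \<open>
  The typing of cells is phrased through \<open>Dom\<close> and \<open>Cod\<close>, so that the simplifier can compute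
  the endpoints of composite cells.
\<close>

context bicategory
begin

lemmas hom_arr_simps =
  category.arr_id[OF hom_category] category.arr_comp[OF hom_category]
  category.dom_ob[OF hom_category] category.cod_ob[OF hom_category]
lemmas hom_comp_Id = category.comp_Id[OF hom_category]
lemmas hom_Id_comp = category.Id_comp[OF hom_category]
lemmas hom_comp_comp = category.comp_comp[OF hom_category]

section \<open>Horizontal composition, interchange and whiskering\<close>

lemma hcomp1_mor:
  assumes "X \<in> Obj B" "Y \<in> Obj B" "Z \<in> Obj B" "f \<in> Mor B X Y" "g \<in> Mor B Y Z"
  shows "HComp1 B X Y Z g f \<in> Mor B X Z"
  using is_functorD(3)[OF hcomp_functor[OF assms(1-3)], of "(g, f)"] assms
  by simp

lemma hcomp2_arr:
  assumes "X \<in> Obj B" "Y \<in> Obj B" "Z \<in> Obj B" "p \<in> Arr (Hom B X Y)" "q \<in> Arr (Hom B Y Z)"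
  shows "HComp2 B X Y Z q p \<in> Arr (Hom B X Z)"
    "Dom (Hom B X Z) (HComp2 B X Y Z q p) = HComp1 B X Y Z (Dom (Hom B Y Z) q) (Dom (Hom B X Y) p)"
    "Cod (Hom B X Z) (HComp2 B X Y Z q p) = HComp1 B X Y Z (Cod (Hom B Y Z) q) (Cod (Hom B X Y) p)"
  using is_functorD(4)[OF hcomp_functor[OF assms(1-3)], of "(q, p)"
      "(Dom (Hom B Y Z) q, Dom (Hom B X Y) p)" "(Cod (Hom B Y Z) q, Cod (Hom B X Y) p)"] assms
  by (auto simp: arrs_def)

lemma hcomp2_id:
  assumes "X \<in> Obj B" "Y \<in> Obj B" "Z \<in> Obj B" "f \<in> Mor B X Y" "g \<in> Mor B Y Z"
  shows "HComp2 B X Y Z (Id (Hom B Y Z) g) (Id (Hom B X Y) f) = Id (Hom B X Z) (HComp1 B X Y Z g f)"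
  using is_functorD(5)[OF hcomp_functor[OF assms(1-3)], of "(g, f)"] assms
  by simp

lemma interchange:
  assumes "X \<in> Obj B" "Y \<in> Obj B" "Z \<in> Obj B" "p \<in> Arr (Hom B X Y)" "q \<in> Arr (Hom B Y Z)"
    "p' \<in> Arr (Hom B X Y)" "q' \<in> Arr (Hom B Y Z)"
    "Cod (Hom B X Y) p = Dom (Hom B X Y) p'" "Cod (Hom B Y Z) q = Dom (Hom B Y Z) q'"
  shows "HComp2 B X Y Z (VComp B Y Z q' q) (VComp B X Y p' p) =
    VComp B X Z (HComp2 B X Y Z q' p') (HComp2 B X Y Z q p)"
  using is_functorD(6)[OF hcomp_functor[OF assms(1-3)], of "(q, p)"
      "(Dom (Hom B Y Z) q, Dom (Hom B X Y) p)" "(Cod (Hom B Y Z) q, Cod (Hom B X Y) p)"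
      "(q', p')" "(Cod (Hom B Y Z) q', Cod (Hom B X Y) p')"] assms
  by (auto simp: arrs_def)

text \<open>Horizontal composition is a functor out of a product category, so it sends a pair of
  isomorphisms to an isomorphism.\<close>

lemma hcomp2_iso:
  assumes "X \<in> Obj B" "Y \<in> Obj B" "Z \<in> Obj B" "p \<in> ICells B X Y f f'" "q \<in> ICells B Y Z g g'"
  shows "HComp2 B X Y Z q p \<in> ICells B X Z (HComp1 B X Y Z g f) (HComp1 B X Y Z g' f')"
  using is_functor_iso[OF hcomp_functor[OF assms(1-3)] isos_prod_cat[OF assms(5,4)]] by simp

lemma lwhisk_comp:
  assumes "X \<in> Obj B" "Y \<in> Obj B" "Z \<in> Obj B" "g \<in> Mor B Y Z"
    "p \<in> Arr (Hom B X Y)" "p' \<in> Arr (Hom B X Y)" "Cod (Hom B X Y) p = Dom (Hom B X Y) p'"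
  shows "LWhisk B X Y Z g (VComp B X Y p' p) =
    VComp B X Z (LWhisk B X Y Z g p') (LWhisk B X Y Z g p)"
  using interchange[of X Y Z p "Id (Hom B Y Z) g" p' "Id (Hom B Y Z) g"] assms
  by (simp add: hom_arr_simps hom_comp_Id)

lemma rwhisk_comp:
  assumes "X \<in> Obj B" "Y \<in> Obj B" "Z \<in> Obj B" "f \<in> Mor B X Y"
    "q \<in> Arr (Hom B Y Z)" "q' \<in> Arr (Hom B Y Z)" "Cod (Hom B Y Z) q = Dom (Hom B Y Z) q'"
  shows "RWhisk B X Y Z (VComp B Y Z q' q) f =
    VComp B X Z (RWhisk B X Y Z q' f) (RWhisk B X Y Z q f)"
  using interchange[of X Y Z "Id (Hom B X Y) f" q "Id (Hom B X Y) f" q'] assms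
  by (simp add: hom_arr_simps hom_comp_Id)

text \<open>By interchange and the identity laws both sides are the horizontal composite of
  \<open>q\<close> and \<open>p\<close>.\<close>

lemma whisk_exchange:
  assumes "X \<in> Obj B" "Y \<in> Obj B" "Z \<in> Obj B" "p \<in> Cells B X Y f f'" "q \<in> Cells B Y Z g g'"
  shows "VComp B X Z (RWhisk B X Y Z q f') (LWhisk B X Y Z g p) =
    VComp B X Z (LWhisk B X Y Z g' p) (RWhisk B X Y Z q f)"
proof -
  have "f \<in> Mor B X Y" "f' \<in> Mor B X Y" "g \<in> Mor B Y Z" "g' \<in> Mor B Y Z"
    using assms category.arrs_ob[OF hom_category] by blast+
  with assms show ?thesis
    by (simp add: arrs_def hom_arr_simps hom_comp_Id hom_Id_comp flip: interchange)
qed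

section \<open>Associator and unitors\<close>

lemma assoc_arr:
  assumes "X \<in> Obj B" "Y \<in> Obj B" "Z \<in> Obj B" "W \<in> Obj B"
    "f \<in> Mor B X Y" "g \<in> Mor B Y Z" "h \<in> Mor B Z W"
  shows "Assoc B X Y Z W h g f \<in> Arr (Hom B X W)"
    "Dom (Hom B X W) (Assoc B X Y Z W h g f) = HComp1 B X Y W (HComp1 B Y Z W h g) f"
    "Cod (Hom B X W) (Assoc B X Y Z W h g f) = HComp1 B X Z W h (HComp1 B X Y Z g f)"
  using assoc_iso[OF assms] by (auto simp: isos_def arrs_def)

lemma lunit_arr:
  assumes "X \<in> Obj B" "Y \<in> Obj B" "f \<in> Mor B X Y"
  shows "LUnit B X Y f \<in> Arr (Hom B X Y)"
    "Dom (Hom B X Y) (LUnit B X Y f) = HComp1 B X Y Y (One B Y) f"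
    "Cod (Hom B X Y) (LUnit B X Y f) = f"
  using lunit_iso[OF assms] by (auto simp: isos_def arrs_def)

lemma runit_arr:
  assumes "X \<in> Obj B" "Y \<in> Obj B" "f \<in> Mor B X Y"
  shows "RUnit B X Y f \<in> Arr (Hom B X Y)"
    "Dom (Hom B X Y) (RUnit B X Y f) = HComp1 B X X Y f (One B X)"
    "Cod (Hom B X Y) (RUnit B X Y f) = f"
  using runit_iso[OF assms] by (auto simp: isos_def arrs_def)

text \<open>Naturality of the associator with identities in the two outer slots. It later carries
  \<open>Mu\<close> and \<open>Theta\<close> past an associator.\<close>

lemma lwhisk_assoc:
  assumes "X \<in> Obj B" "Y \<in> Obj B" "Z \<in> Obj B" "W \<in> Obj B"
    "f \<in> Mor B X Y" "q \<in> Cells B Y Z g g'" "h \<in> Mor B Z W"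
  shows "VComp B X W (LWhisk B X Z W h (RWhisk B X Y Z q f)) (Assoc B X Y Z W h g f) =
    VComp B X W (Assoc B X Y Z W h g' f) (RWhisk B X Y W (LWhisk B Y Z W h q) f)"
proof -
  have "g \<in> Mor B Y Z" "g' \<in> Mor B Y Z"
    using assms category.arrs_ob[OF hom_category] by blast+
  with assms show ?thesis
    by (intro assoc_natural[symmetric]) (auto intro!: category.id_arr[OF hom_category])
qed

lemma rwhisk_assoc:
  assumes "X \<in> Obj B" "Y \<in> Obj B" "Z \<in> Obj B" "W \<in> Obj B"
    "f \<in> Mor B X Y" "g \<in> Mor B Y Z" "r \<in> Cells B Z W h h'"
  shows "VComp B X W (RWhisk B X Z W r (HComp1 B X Y Z g f)) (Assoc B X Y Z W h g f) =
    VComp B X W (Assoc B X Y Z W h' g f) (RWhisk B X Y W (RWhisk B Y Z W r g) f)"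
proof -
  have "h \<in> Mor B Z W" "h' \<in> Mor B Z W"
    using assms category.arrs_ob[OF hom_category] by blast+
  with assms show ?thesis
    \<comment> \<open>With identities on \<open>f\<close> and \<open>g\<close>, naturality produces
      the horizontal composite of two identities, which \<open>hcomp2_id\<close> fuses into the
      identity of the composite 1-cell.\<close>
    by (subst assoc_natural[where f' = f and g' = g and h = h])
      (auto simp: hcomp2_id intro!: category.id_arr[OF hom_category])
qed

lemmas arr_simps = hom_arr_simps hcomp1_mor hcomp2_arr assoc_arr lunit_arr runit_arr one_mor

end

section \<open>The Kleisli bicategory\<close>

context relative_pseudomonad
begin

abbreviation JO where "JO \<equiv> PfObj J"
abbreviation TO where "TO \<equiv> TObj T"

section \<open>Typing and functoriality of the pseudomonad data\<close>

lemma ext1_mor: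
  assumes "X \<in> Obj C" "Y \<in> Obj C" "f \<in> Mor D (JO X) (TO Y)"
  shows "Ext1 T X Y f \<in> Mor D (TO X) (TO Y)"
  using is_functorD(3)[OF ext_functor[OF assms(1,2)] assms(3)] .

lemma ext2_arr:
  assumes "X \<in> Obj C" "Y \<in> Obj C" "p \<in> Arr (Hom D (JO X) (TO Y))"
  shows "Ext2 T X Y p \<in> Arr (Hom D (TO X) (TO Y))"
    "Dom (Hom D (TO X) (TO Y)) (Ext2 T X Y p) = Ext1 T X Y (Dom (Hom D (JO X) (TO Y)) p)"
    "Cod (Hom D (TO X) (TO Y)) (Ext2 T X Y p) = Ext1 T X Y (Cod (Hom D (JO X) (TO Y)) p)"
  using is_functorD(4)[OF ext_functor[OF assms(1,2)], of p] assms by (auto simp: arrs_def)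

lemma ext2_id:
  assumes "X \<in> Obj C" "Y \<in> Obj C" "f \<in> Mor D (JO X) (TO Y)"
  shows "Ext2 T X Y (Id (Hom D (JO X) (TO Y)) f) = Id (Hom D (TO X) (TO Y)) (Ext1 T X Y f)"
  using is_functorD(5)[OF ext_functor[OF assms(1,2)] assms(3)] .

lemma ext2_comp:
  assumes "X \<in> Obj C" "Y \<in> Obj C" "p \<in> Arr (Hom D (JO X) (TO Y))" "q \<in> Arr (Hom D (JO X) (TO Y))"
    "Cod (Hom D (JO X) (TO Y)) p = Dom (Hom D (JO X) (TO Y)) q"
  shows "Ext2 T X Y (VComp D (JO X) (TO Y) q p) =
    VComp D (TO X) (TO Y) (Ext2 T X Y q) (Ext2 T X Y p)"
  using is_functorD(6)[OF ext_functor[OF assms(1,2)], of p _ _ q] assms by (auto simp: arrs_def)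

lemma mu_arr:
  assumes "X \<in> Obj C" "Y \<in> Obj C" "Z \<in> Obj C" "f \<in> Mor D (JO X) (TO Y)" "g \<in> Mor D (JO Y) (TO Z)"
  shows "Mu T X Y Z g f \<in> Arr (Hom D (TO X) (TO Z))"
    "Dom (Hom D (TO X) (TO Z)) (Mu T X Y Z g f) =
      Ext1 T X Z (HComp1 D (JO X) (TO Y) (TO Z) (Ext1 T Y Z g) f)"
    "Cod (Hom D (TO X) (TO Z)) (Mu T X Y Z g f) =
      HComp1 D (TO X) (TO Y) (TO Z) (Ext1 T Y Z g) (Ext1 T X Y f)"
  using mu_iso[OF assms] by (auto simp: isos_def arrs_def)

lemma eta_arr:
  assumes "X \<in> Obj C" "Y \<in> Obj C" "f \<in> Mor D (JO X) (TO Y)"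
  shows "Eta T X Y f \<in> Arr (Hom D (JO X) (TO Y))"
    "Dom (Hom D (JO X) (TO Y)) (Eta T X Y f) = f"
    "Cod (Hom D (JO X) (TO Y)) (Eta T X Y f) = HComp1 D (JO X) (TO X) (TO Y) (Ext1 T X Y f) (I T X)"
  using eta_iso[OF assms] by (auto simp: isos_def arrs_def)

lemma theta_arr:
  assumes "X \<in> Obj C"
  shows "Theta T X \<in> Arr (Hom D (TO X) (TO X))"
    "Dom (Hom D (TO X) (TO X)) (Theta T X) = Ext1 T X X (I T X)"
    "Cod (Hom D (TO X) (TO X)) (Theta T X) = One D (TO X)"
  using theta_iso[OF assms] by (auto simp: isos_def arrs_def)

lemmas psm_simps = D.arr_simps pf_obj t_obj ext1_mor ext2_arr i_mor mu_arr eta_arr theta_arr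

text \<open>\<open>Mu\<close> and \<open>Theta\<close> point the same way as an associator and a
  left unitor, so they only need whiskering, followed by the associator or left unitor of
  \<open>D\<close>. \<open>Eta\<close> points against a right unitor and has to be inverted.\<close>

definition Kl :: "('o, 'n, 'd) bicat" where
  "Kl = \<lparr>Obj = Obj C,
     Hom = (\<lambda>X Y. Hom D (JO X) (TO Y)),
     One = I T,
     HComp1 = (\<lambda>X Y Z g f. HComp1 D (JO X) (TO Y) (TO Z) (Ext1 T Y Z g) f),
     HComp2 = (\<lambda>X Y Z q p. HComp2 D (JO X) (TO Y) (TO Z) (Ext2 T Y Z q) p),
     Assoc = (\<lambda>X Y Z V h g f. VComp D (JO X) (TO V)
       (Assoc D (JO X) (TO Y) (TO Z) (TO V) (Ext1 T Z V h) (Ext1 T Y Z g) f)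
       (RWhisk D (JO X) (TO Y) (TO V) (Mu T Y Z V h g) f)),
     LUnit = (\<lambda>X Y f. VComp D (JO X) (TO Y) (LUnit D (JO X) (TO Y) f)
       (RWhisk D (JO X) (TO Y) (TO Y) (Theta T Y) f)),
     RUnit = (\<lambda>X Y f. inv_arr (Hom D (JO X) (TO Y)) f
       (HComp1 D (JO X) (TO X) (TO Y) (Ext1 T X Y f) (I T X)) (Eta T X Y f))\<rparr>"

text \<open>Kleisli composition is composition of \<open>D\<close> precomposed with the product of
  the extension functor and the identity; a composite of functors is a functor.\<close>

lemma Kl_hcomp_functor:
  assumes "X \<in> Obj C" "Y \<in> Obj C" "Z \<in> Obj C"
  shows "is_functor (prod_cat (Hom D (JO Y) (TO Z)) (Hom D (JO X) (TO Y))) (Hom D (JO X) (TO Z))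
    (\<lambda>(g, f). HComp1 D (JO X) (TO Y) (TO Z) (Ext1 T Y Z g) f)
    (\<lambda>(q, p). HComp2 D (JO X) (TO Y) (TO Z) (Ext2 T Y Z q) p)"
proof -
  have eqs: "(\<lambda>(g, f). HComp1 D (JO X) (TO Y) (TO Z) (Ext1 T Y Z g) f) =
      (\<lambda>(g, f). HComp1 D (JO X) (TO Y) (TO Z) g f) \<circ> map_prod (Ext1 T Y Z) id"
    "(\<lambda>(q, p). HComp2 D (JO X) (TO Y) (TO Z) (Ext2 T Y Z q) p) =
      (\<lambda>(q, p). HComp2 D (JO X) (TO Y) (TO Z) q p) \<circ> map_prod (Ext2 T Y Z) id"
    by auto
  show ?thesis
    unfolding eqs using assms
    by (intro is_functor_comp[OF is_functor_map_prod D.hcomp_functor] ext_functor is_functor_id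
        D.hom_category pf_obj t_obj)
qed

section \<open>Invertibility and naturality of the constraint cells\<close>

lemma Kl_assoc_iso:
  assumes "X \<in> Obj C" "Y \<in> Obj C" "Z \<in> Obj C" "W \<in> Obj C"
    "f \<in> Mor D (JO X) (TO Y)" "g \<in> Mor D (JO Y) (TO Z)" "h \<in> Mor D (JO Z) (TO W)"
  shows "VComp D (JO X) (TO W)
      (Assoc D (JO X) (TO Y) (TO Z) (TO W) (Ext1 T Z W h) (Ext1 T Y Z g) f)
      (RWhisk D (JO X) (TO Y) (TO W) (Mu T Y Z W h g) f) \<in>
    ICells D (JO X) (TO W)
      (HComp1 D (JO X) (TO Y) (TO W)
        (Ext1 T Y W (HComp1 D (JO Y) (TO Z) (TO W) (Ext1 T Z W h) g)) f)
      (HComp1 D (JO X) (TO Z) (TO W) (Ext1 T Z W h)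
        (HComp1 D (JO X) (TO Y) (TO Z) (Ext1 T Y Z g) f))"
  using assms
  by (intro category.comp_iso[OF D.hom_category
        D.hcomp2_iso[OF _ _ _ category.id_iso[OF D.hom_category] mu_iso] D.assoc_iso])
    (simp_all add: psm_simps)

text \<open>Paste two naturality squares: that of \<open>Mu\<close>, composed horizontally with
  \<open>p\<close>, and that of the associator of \<open>D\<close>.\<close>

lemma Kl_assoc_natural:
  assumes o: "X \<in> Obj C" "Y \<in> Obj C" "Z \<in> Obj C" "W \<in> Obj C"
    and m: "f \<in> Mor D (JO X) (TO Y)" "f' \<in> Mor D (JO X) (TO Y)"
      "g \<in> Mor D (JO Y) (TO Z)" "g' \<in> Mor D (JO Y) (TO Z)"
      "h \<in> Mor D (JO Z) (TO W)" "h' \<in> Mor D (JO Z) (TO W)"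
    and c: "p \<in> Cells D (JO X) (TO Y) f f'" "q \<in> Cells D (JO Y) (TO Z) g g'"
      "r \<in> Cells D (JO Z) (TO W) h h'"
  shows "VComp D (JO X) (TO W)
      (VComp D (JO X) (TO W)
        (Assoc D (JO X) (TO Y) (TO Z) (TO W) (Ext1 T Z W h') (Ext1 T Y Z g') f')
        (RWhisk D (JO X) (TO Y) (TO W) (Mu T Y Z W h' g') f'))
      (HComp2 D (JO X) (TO Y) (TO W)
        (Ext2 T Y W (HComp2 D (JO Y) (TO Z) (TO W) (Ext2 T Z W r) q)) p) =
    VComp D (JO X) (TO W)
      (HComp2 D (JO X) (TO Z) (TO W) (Ext2 T Z W r)
        (HComp2 D (JO X) (TO Y) (TO Z) (Ext2 T Y Z q) p))
      (VComp D (JO X) (TO W)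
        (Assoc D (JO X) (TO Y) (TO Z) (TO W) (Ext1 T Z W h) (Ext1 T Y Z g) f)
        (RWhisk D (JO X) (TO Y) (TO W) (Mu T Y Z W h g) f))"
    (is "VComp _ _ _ (VComp _ _ _ ?a' ?m') ?s = VComp _ _ _ ?t (VComp _ _ _ ?a ?m)")
proof -
  let ?v = "VComp D (JO X) (TO W)"
  note ty = o m c[unfolded arrs_def]
  have "?v (?v ?a' ?m') ?s = ?v ?a' (?v ?m' ?s)"
    using ty by (simp add: D.hom_comp_comp psm_simps)
  \<comment> \<open>Interchange read backwards absorbs the identity on \<open>f'\<close> into
    \<open>p\<close> and leaves a vertical composite in the left slot, where
    \<open>mu_natural\<close> can act.\<close>
  also have "?v ?m' ?s = HComp2 D (JO X) (TO Y) (TO W) (VComp D (TO Y) (TO W) (Mu T Y Z W h' g')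
      (Ext2 T Y W (HComp2 D (JO Y) (TO Z) (TO W) (Ext2 T Z W r) q))) p"
    using ty by (simp add: psm_simps D.hom_Id_comp flip: D.interchange)
  also have "\<dots> = ?v (HComp2 D (JO X) (TO Y) (TO W)
      (HComp2 D (TO Y) (TO Z) (TO W) (Ext2 T Z W r) (Ext2 T Y Z q)) p) ?m"
    using ty c by (simp add: psm_simps D.hom_comp_Id mu_natural flip: D.interchange)
  also have "?v ?a' \<dots> = ?v (?v ?a' (HComp2 D (JO X) (TO Y) (TO W)
      (HComp2 D (TO Y) (TO Z) (TO W) (Ext2 T Z W r) (Ext2 T Y Z q)) p)) ?m"
    using ty by (simp add: D.hom_comp_comp psm_simps)
  also have "\<dots> = ?v (?v ?t ?a) ?m"
    \<comment> \<open>The source 1-cells occur only on the right of the naturality equation, so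
      matching its left side does not determine them.\<close>
    using ty by (subst D.assoc_natural[where f = f and g = "Ext1 T Y Z g" and h = "Ext1 T Z W h"])
      (simp_all add: psm_simps arrs_def)
  also have "\<dots> = ?v ?t (?v ?a ?m)"
    using ty by (simp add: D.hom_comp_comp psm_simps)
  finally show ?thesis .
qed

lemma Kl_lunit_iso:
  assumes "X \<in> Obj C" "Y \<in> Obj C" "f \<in> Mor D (JO X) (TO Y)"
  shows "VComp D (JO X) (TO Y) (LUnit D (JO X) (TO Y) f)
      (RWhisk D (JO X) (TO Y) (TO Y) (Theta T Y) f) \<in>
    ICells D (JO X) (TO Y) (HComp1 D (JO X) (TO Y) (TO Y) (Ext1 T Y Y (I T Y)) f) f"
  using assms
  by (intro category.comp_iso[OF D.hom_category
        D.hcomp2_iso[OF _ _ _ category.id_iso[OF D.hom_category] theta_iso] D.lunit_iso])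
    (simp_all add: psm_simps)

text \<open>\<open>p\<close> passes the whiskered \<open>Theta\<close> by exchange and then the left
  unitor of \<open>D\<close> by naturality.\<close>

lemma Kl_lunit_natural:
  assumes o: "X \<in> Obj C" "Y \<in> Obj C" "f \<in> Mor D (JO X) (TO Y)" "f' \<in> Mor D (JO X) (TO Y)"
    and p: "p \<in> Cells D (JO X) (TO Y) f f'"
  shows "VComp D (JO X) (TO Y)
      (VComp D (JO X) (TO Y) (LUnit D (JO X) (TO Y) f')
        (RWhisk D (JO X) (TO Y) (TO Y) (Theta T Y) f'))
      (LWhisk D (JO X) (TO Y) (TO Y) (Ext1 T Y Y (I T Y)) p) =
    VComp D (JO X) (TO Y) p
      (VComp D (JO X) (TO Y) (LUnit D (JO X) (TO Y) f)
        (RWhisk D (JO X) (TO Y) (TO Y) (Theta T Y) f))"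
    (is "VComp _ _ _ (VComp _ _ _ ?l' ?t') ?s = VComp _ _ _ p (VComp _ _ _ ?l ?t)")
proof -
  let ?v = "VComp D (JO X) (TO Y)"
  note ty = o p[unfolded arrs_def]
  have "?v (?v ?l' ?t') ?s = ?v ?l' (?v ?t' ?s)"
    using ty by (simp add: D.hom_comp_comp psm_simps)
  also have "?v ?t' ?s = ?v (LWhisk D (JO X) (TO Y) (TO Y) (One D (TO Y)) p) ?t"
    using o p by (intro D.whisk_exchange) (simp_all add: psm_simps arrs_def)
  also have "?v ?l' \<dots> = ?v (?v ?l' (LWhisk D (JO X) (TO Y) (TO Y) (One D (TO Y)) p)) ?t"
    using ty by (simp add: D.hom_comp_comp psm_simps)
  also have "\<dots> = ?v (?v p ?l) ?t"
    using o p by (subst D.lunit_natural) (simp_all add: psm_simps)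
  also have "\<dots> = ?v p (?v ?l ?t)"
    using ty by (simp add: D.hom_comp_comp psm_simps)
  finally show ?thesis .
qed

text \<open>The componentwise inverse of a natural isomorphism is natural, here for
  \<open>Eta\<close>.\<close>

lemma Kl_runit_natural:
  assumes o: "X \<in> Obj C" "Y \<in> Obj C" "f \<in> Mor D (JO X) (TO Y)" "f' \<in> Mor D (JO X) (TO Y)"
    and p: "p \<in> Cells D (JO X) (TO Y) f f'"
  shows "VComp D (JO X) (TO Y)
      (inv_arr (Hom D (JO X) (TO Y)) f'
        (HComp1 D (JO X) (TO X) (TO Y) (Ext1 T X Y f') (I T X)) (Eta T X Y f'))
      (RWhisk D (JO X) (TO X) (TO Y) (Ext2 T X Y p) (I T X)) =
    VComp D (JO X) (TO Y) p
      (inv_arr (Hom D (JO X) (TO Y)) f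
        (HComp1 D (JO X) (TO X) (TO Y) (Ext1 T X Y f) (I T X)) (Eta T X Y f))"
    (is "VComp _ _ _ ?r' ?s = VComp _ _ _ p ?r")
proof -
  let ?v = "VComp D (JO X) (TO Y)"
  note ty = o p[unfolded arrs_def]
    inv_arr(1)[OF eta_iso[OF o(1,2,3)], unfolded arrs_def]
    inv_arr(1)[OF eta_iso[OF o(1,2,4)], unfolded arrs_def]
  \<comment> \<open>Inserting \<open>Eta\<close> after its inverse \<open>?r\<close> creates the
    side of \<open>eta_natural\<close> to be rewritten; afterwards \<open>?r'\<close> cancels the
    other \<open>Eta\<close>.\<close>
  have "?v ?r' ?s = ?v ?r' (?v ?s (?v (Eta T X Y f) ?r))"
    using ty by (simp add: inv_arr(3)[OF eta_iso] D.hom_comp_Id psm_simps)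
  also have "\<dots> = ?v ?r' (?v (?v ?s (Eta T X Y f)) ?r)"
    using ty by (simp add: D.hom_comp_comp psm_simps)
  also have "\<dots> = ?v ?r' (?v (?v (Eta T X Y f') p) ?r)"
    using o p by (subst eta_natural) simp_all
  also have "\<dots> = ?v (?v (?v ?r' (Eta T X Y f')) p) ?r"
    using ty by (simp add: D.hom_comp_comp psm_simps)
  also have "\<dots> = ?v p ?r"
    using ty by (simp add: inv_arr(2)[OF eta_iso] D.hom_Id_comp psm_simps)
  finally show ?thesis .
qed

section \<open>Coherence: pentagon and triangle\<close>

text \<open>Each Kleisli associator is an associator of \<open>D\<close> after a whiskered
  \<open>Mu\<close>. Moving the \<open>Mu\<close> cells past the associators makes two associators
  adjacent, so that \<open>D.pentagon\<close> applies, and collects the rest under whiskering with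
  \<open>f\<close>, where \<open>associativity\<close> applies. The result is then sorted back into
  Kleisli associators.\<close>

lemma Kl_pentagon:
  assumes o: "X \<in> Obj C" "Y \<in> Obj C" "Z \<in> Obj C" "W \<in> Obj C" "V \<in> Obj C"
    and m: "f \<in> Mor D (JO X) (TO Y)" "g \<in> Mor D (JO Y) (TO Z)"
      "h \<in> Mor D (JO Z) (TO W)" "k \<in> Mor D (JO W) (TO V)"
  defines "gf \<equiv> HComp1 D (JO X) (TO Y) (TO Z) (Ext1 T Y Z g) f"
    and "hg \<equiv> HComp1 D (JO Y) (TO Z) (TO W) (Ext1 T Z W h) g"
    and "kh \<equiv> HComp1 D (JO Z) (TO W) (TO V) (Ext1 T W V k) h"
  shows "VComp D (JO X) (TO V)
      (VComp D (JO X) (TO V)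
        (Assoc D (JO X) (TO Z) (TO W) (TO V) (Ext1 T W V k) (Ext1 T Z W h) gf)
        (RWhisk D (JO X) (TO Z) (TO V) (Mu T Z W V k h) gf))
      (VComp D (JO X) (TO V)
        (Assoc D (JO X) (TO Y) (TO Z) (TO V) (Ext1 T Z V kh) (Ext1 T Y Z g) f)
        (RWhisk D (JO X) (TO Y) (TO V) (Mu T Y Z V kh g) f)) =
    VComp D (JO X) (TO V)
      (LWhisk D (JO X) (TO W) (TO V) (Ext1 T W V k)
        (VComp D (JO X) (TO W)
          (Assoc D (JO X) (TO Y) (TO Z) (TO W) (Ext1 T Z W h) (Ext1 T Y Z g) f)
          (RWhisk D (JO X) (TO Y) (TO W) (Mu T Y Z W h g) f)))
      (VComp D (JO X) (TO V)
        (VComp D (JO X) (TO V)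
          (Assoc D (JO X) (TO Y) (TO W) (TO V) (Ext1 T W V k) (Ext1 T Y W hg) f)
          (RWhisk D (JO X) (TO Y) (TO V) (Mu T Y W V k hg) f))
        (RWhisk D (JO X) (TO Y) (TO V)
          (Ext2 T Y V
            (VComp D (JO Y) (TO V)
              (Assoc D (JO Y) (TO Z) (TO W) (TO V) (Ext1 T W V k) (Ext1 T Z W h) g)
              (RWhisk D (JO Y) (TO Z) (TO V) (Mu T Z W V k h) g))) f))"
    (is "VComp _ _ _ (VComp _ _ _ ?a1 ?m1) (VComp _ _ _ ?a2 ?m2) =
      VComp _ _ _ (LWhisk _ _ _ _ _ (VComp _ _ _ ?a3 ?m3))
        (VComp _ _ _ (VComp _ _ _ ?a4 ?m4)
          (RWhisk _ _ _ _ (Ext2 _ _ _ (VComp _ _ _ ?a5 ?m5)) _))")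
proof -
  let ?v = "VComp D (JO X) (TO V)"
  let ?L = "LWhisk D (JO X) (TO W) (TO V) (Ext1 T W V k)"
  let ?R = "\<lambda>q. RWhisk D (JO X) (TO Y) (TO V) q f"
  let ?w = "VComp D (TO Y) (TO V)"
  let ?k = "Ext1 T W V k" and ?h = "Ext1 T Z W h" and ?g = "Ext1 T Y Z g"
  let ?mg = "RWhisk D (TO Y) (TO Z) (TO V) (Mu T Z W V k h) ?g"
  let ?km = "LWhisk D (TO Y) (TO W) (TO V) ?k (Mu T Y Z W h g)"
  let ?a6 = "Assoc D (JO X) (TO Y) (TO Z) (TO V) (HComp1 D (TO Z) (TO W) (TO V) ?k ?h) ?g f"
  let ?a7 = "Assoc D (JO X) (TO Y) (TO W) (TO V) ?k (HComp1 D (TO Y) (TO Z) (TO W) ?h ?g) f"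
  let ?a8 = "Assoc D (TO Y) (TO Z) (TO W) (TO V) ?k ?h ?g"
  note ty = psm_simps gf_def hg_def kh_def
  have "?v (?v ?a1 ?m1) (?v ?a2 ?m2) = ?v ?a1 (?v (?v ?m1 ?a2) ?m2)"
    using o m by (simp add: D.hom_comp_comp ty)
  also have "?v ?m1 ?a2 = ?v ?a6 (?R ?mg)"
    unfolding gf_def using o m by (intro D.rwhisk_assoc) (simp_all add: ty arrs_def)
  also have "?v ?a1 (?v (?v ?a6 (?R ?mg)) ?m2) = ?v (?v ?a1 ?a6) (?v (?R ?mg) ?m2)"
    using o m by (simp add: D.hom_comp_comp ty)
  \<comment> \<open>The last of the three associators obtained is whiskered with \<open>f\<close>;
    together with \<open>?mg\<close> and the remaining \<open>Mu\<close> it forms the right side of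
    \<open>associativity\<close>.\<close>
  also have "?v ?a1 ?a6 = ?v (?L ?a3) (?v ?a7 (?R ?a8))"
    unfolding gf_def using o m by (intro D.pentagon) (simp_all add: ty)
  also have "?v \<dots> (?v (?R ?mg) ?m2) = ?v (?L ?a3) (?v ?a7 (?R (?w ?a8 (?w ?mg (Mu T Y Z V kh g)))))"
    using o m by (simp add: D.hom_comp_comp D.rwhisk_comp ty)
  \<comment> \<open>The axiom, read from right to left for the triple \<open>g\<close>,
    \<open>h\<close>, \<open>k\<close>, acts inside \<open>?R\<close>.\<close>
  also have "?w ?a8 (?w ?mg (Mu T Y Z V kh g)) =
      ?w ?km (?w (Mu T Y W V k hg) (?w (Ext2 T Y V ?a5) (Ext2 T Y V ?m5)))"
    unfolding hg_def kh_def using o m by (intro associativity[symmetric])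
  also have "?v (?L ?a3) (?v ?a7 (?R \<dots>)) =
      ?v (?L ?a3) (?v (?v ?a7 (?R ?km)) (?v ?m4 (?v (?R (Ext2 T Y V ?a5)) (?R (Ext2 T Y V ?m5)))))"
    using o m by (simp add: D.hom_comp_comp D.rwhisk_comp ty)
  \<comment> \<open>\<open>Mu\<close> for \<open>h\<close> and \<open>g\<close> leaves the
    whiskering with \<open>f\<close> and joins \<open>?a3\<close> under \<open>?L\<close>,
    completing the Kleisli associator of \<open>h\<close>, \<open>g\<close>,
    \<open>f\<close>.\<close>
  also have "?v ?a7 (?R ?km) = ?v (?L ?m3) ?a4"
    using o m by (intro D.lwhisk_assoc[symmetric]) (simp_all add: ty arrs_def)
  also have "?v (?L ?a3) (?v (?v (?L ?m3) ?a4)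
        (?v ?m4 (?v (?R (Ext2 T Y V ?a5)) (?R (Ext2 T Y V ?m5))))) =
      ?v (?L (VComp D (JO X) (TO W) ?a3 ?m3))
        (?v (?v ?a4 ?m4) (?R (Ext2 T Y V (VComp D (JO Y) (TO V) ?a5 ?m5))))"
    using o m by (simp add: D.hom_comp_comp D.lwhisk_comp D.rwhisk_comp ext2_comp ty)
  finally show ?thesis .
qed

text \<open>By \<open>unit\<close> the right side is a left inverse of the extended
  \<open>Eta\<close>; by functoriality of the extension, \<open>Ext2 T X Y r\<close> is a right
  inverse. A left and a right inverse of the same cell coincide.\<close>

lemma ext2_inv_eta:
  assumes o: "X \<in> Obj C" "Y \<in> Obj C" "f \<in> Mor D (JO X) (TO Y)"
  defines "r \<equiv> inv_arr (Hom D (JO X) (TO Y)) f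
      (HComp1 D (JO X) (TO X) (TO Y) (Ext1 T X Y f) (I T X)) (Eta T X Y f)"
  shows "Ext2 T X Y r =
    VComp D (TO X) (TO Y) (RUnit D (TO X) (TO Y) (Ext1 T X Y f))
      (VComp D (TO X) (TO Y) (LWhisk D (TO X) (TO X) (TO Y) (Ext1 T X Y f) (Theta T X))
        (Mu T X X Y f (I T X)))"
    (is "_ = VComp _ _ _ ?u (VComp _ _ _ ?t ?m)")
proof -
  let ?v = "VComp D (TO X) (TO Y)"
  note ty = o inv_arr(1)[OF eta_iso[OF o], unfolded arrs_def, folded r_def]
  have "Ext2 T X Y r = ?v (?v ?u (?v ?t (?v ?m (Ext2 T X Y (Eta T X Y f))))) (Ext2 T X Y r)"
    using ty by (simp add: unit D.hom_Id_comp psm_simps)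
  also have "\<dots> = ?v (?v ?u (?v ?t ?m)) (Ext2 T X Y (VComp D (JO X) (TO Y) (Eta T X Y f) r))"
    using ty by (simp add: D.hom_comp_comp ext2_comp psm_simps)
  also have "\<dots> = ?v ?u (?v ?t ?m)"
    using ty by (simp add: inv_arr(3)[OF eta_iso] r_def D.hom_comp_Id ext2_id psm_simps)
  finally show ?thesis .
qed

lemma Kl_triangle:
  assumes o: "X \<in> Obj C" "Y \<in> Obj C" "Z \<in> Obj C" "f \<in> Mor D (JO X) (TO Y)" "g \<in> Mor D (JO Y) (TO Z)"
  shows "VComp D (JO X) (TO Z)
      (LWhisk D (JO X) (TO Y) (TO Z) (Ext1 T Y Z g)
        (VComp D (JO X) (TO Y) (LUnit D (JO X) (TO Y) f)
          (RWhisk D (JO X) (TO Y) (TO Y) (Theta T Y) f)))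
      (VComp D (JO X) (TO Z)
        (Assoc D (JO X) (TO Y) (TO Y) (TO Z) (Ext1 T Y Z g) (Ext1 T Y Y (I T Y)) f)
        (RWhisk D (JO X) (TO Y) (TO Z) (Mu T Y Y Z g (I T Y)) f)) =
    RWhisk D (JO X) (TO Y) (TO Z)
      (Ext2 T Y Z (inv_arr (Hom D (JO Y) (TO Z)) g
        (HComp1 D (JO Y) (TO Y) (TO Z) (Ext1 T Y Z g) (I T Y)) (Eta T Y Z g))) f"
    (is "VComp _ _ _ (LWhisk _ _ _ _ _ (VComp _ _ _ ?l ?t))
        (VComp _ _ _ ?a (RWhisk _ _ _ _ ?m _)) = RWhisk _ _ _ _ (Ext2 _ _ _ ?r) _")
proof -
  let ?v = "VComp D (JO X) (TO Z)"
  let ?L = "LWhisk D (JO X) (TO Y) (TO Z) (Ext1 T Y Z g)"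
  let ?R = "\<lambda>q. RWhisk D (JO X) (TO Y) (TO Z) q f"
  let ?g = "Ext1 T Y Z g"
  let ?a1 = "Assoc D (JO X) (TO Y) (TO Y) (TO Z) ?g (One D (TO Y)) f"
  let ?gt = "LWhisk D (TO Y) (TO Y) (TO Z) ?g (Theta T Y)"
  have "?v (?L (VComp D (JO X) (TO Y) ?l ?t)) (?v ?a (?R ?m)) = ?v (?L ?l) (?v (?v (?L ?t) ?a) (?R ?m))"
    using o by (simp add: D.hom_comp_comp D.lwhisk_comp psm_simps)
  \<comment> \<open>Moving \<open>Theta\<close> past the associator turns the middle argument from
    the extended unit into \<open>One D (TO Y)\<close>, as the triangle of \<open>D\<close>
    requires.\<close>
  also have "?v (?L ?t) ?a = ?v ?a1 (?R ?gt)"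
    using o by (intro D.lwhisk_assoc) (simp_all add: psm_simps arrs_def)
  also have "?v (?L ?l) (?v \<dots> (?R ?m)) = ?v (?v (?L ?l) ?a1) (?v (?R ?gt) (?R ?m))"
    using o by (simp add: D.hom_comp_comp psm_simps)
  also have "?v (?L ?l) ?a1 = ?R (RUnit D (TO Y) (TO Z) ?g)"
    using o by (intro D.triangle) (simp_all add: psm_simps)
  also have "?v \<dots> (?v (?R ?gt) (?R ?m)) =
      ?R (VComp D (TO Y) (TO Z) (RUnit D (TO Y) (TO Z) ?g) (VComp D (TO Y) (TO Z) ?gt ?m))"
    using o by (simp add: D.rwhisk_comp psm_simps)
  also have "\<dots> = ?R (Ext2 T Y Z ?r)"
    using o by (simp add: ext2_inv_eta)
  finally show ?thesis .
qed

lemma bicategory_Kl: "bicategory Kl"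
proof (rule bicategory.intro)
  fix X Y Z assume "X \<in> Obj Kl" "Y \<in> Obj Kl" "Z \<in> Obj Kl"
  then show "is_functor (prod_cat (Hom Kl Y Z) (Hom Kl X Y)) (Hom Kl X Z)
    (\<lambda>(g, f). HComp1 Kl X Y Z g f) (\<lambda>(q, p). HComp2 Kl X Y Z q p)"
    using Kl_hcomp_functor[of X Y Z] by (simp add: Kl_def)
\<comment> \<open>Left whiskering in \<open>Kl\<close> extends an identity cell;
  \<open>ext2_id\<close> turns it into whiskering in \<open>D\<close> by the extended 1-cell, the
  form used in the lemmas above.\<close>
qed (simp_all add: Kl_def D.hom_category ext2_id i_mor Kl_assoc_iso Kl_assoc_natural Kl_lunit_iso
      Kl_lunit_natural Kl_runit_natural Kl_pentagon Kl_triangle inv_arr_iso[OF eta_iso] psm_simps)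

end

theorem theorem4p1:
  fixes C :: "('o, 'm, 'c) bicat"
    and D :: "('p, 'n, 'd) bicat"
    and J :: "('o, 'm, 'c, 'p, 'n, 'd) pseudofun"
    and T :: "('o, 'p, 'n, 'd) relpsmonad"
  assumes "bicategory C" and "bicategory D"
    and "pseudofunctor C D J"
    and "relative_pseudomonad C D J T"
  shows "\<exists>Kl :: ('o, 'n, 'd) bicat.
    bicategory Kl
    \<and> Obj Kl = Obj C
    \<and> (\<forall>X\<in>Obj C. \<forall>Y\<in>Obj C. Hom Kl X Y = Hom D (PfObj J X) (TObj T Y))
    \<and> (\<forall>X\<in>Obj C. One Kl X = I T X)
    \<and> (\<forall>X\<in>Obj C. \<forall>Y\<in>Obj C. \<forall>Z\<in>Obj C.
         \<forall>f \<in> Mor D (PfObj J X) (TObj T Y). \<forall>g \<in> Mor D (PfObj J Y) (TObj T Z).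
           HComp1 Kl X Y Z g f = HComp1 D (PfObj J X) (TObj T Y) (TObj T Z) (Ext1 T Y Z g) f)
    \<and> (\<forall>X\<in>Obj C. \<forall>Y\<in>Obj C. \<forall>Z\<in>Obj C.
         \<forall>p \<in> Arr (Hom D (PfObj J X) (TObj T Y)). \<forall>q \<in> Arr (Hom D (PfObj J Y) (TObj T Z)).
           HComp2 Kl X Y Z q p = HComp2 D (PfObj J X) (TObj T Y) (TObj T Z) (Ext2 T Y Z q) p)
    \<and> (\<forall>X\<in>Obj C. \<forall>Y\<in>Obj C. \<forall>Z\<in>Obj C. \<forall>V\<in>Obj C.
         \<forall>f \<in> Mor D (PfObj J X) (TObj T Y). \<forall>g \<in> Mor D (PfObj J Y) (TObj T Z).
         \<forall>h \<in> Mor D (PfObj J Z) (TObj T V).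
           Assoc Kl X Y Z V h g f =
             VComp D (PfObj J X) (TObj T V)
               (Assoc D (PfObj J X) (TObj T Y) (TObj T Z) (TObj T V)
                  (Ext1 T Z V h) (Ext1 T Y Z g) f)
               (RWhisk D (PfObj J X) (TObj T Y) (TObj T V) (Mu T Y Z V h g) f))
    \<and> (\<forall>X\<in>Obj C. \<forall>Y\<in>Obj C. \<forall>f \<in> Mor D (PfObj J X) (TObj T Y).
         LUnit Kl X Y f =
           VComp D (PfObj J X) (TObj T Y)
             (LUnit D (PfObj J X) (TObj T Y) f)
             (RWhisk D (PfObj J X) (TObj T Y) (TObj T Y) (Theta T Y) f))
    \<and> (\<forall>X\<in>Obj C. \<forall>Y\<in>Obj C. \<forall>f \<in> Mor D (PfObj J X) (TObj T Y).
         VComp D (PfObj J X) (TObj T Y) (RUnit Kl X Y f) (Eta T X Y f) =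
           Id (Hom D (PfObj J X) (TObj T Y)) f)"
proof -
  interpret relative_pseudomonad C D J T by fact
  show ?thesis
    \<comment> \<open>The conjunct on \<open>RUnit\<close> is the left inverse law of
      \<open>inv_arr\<close>; as \<open>Eta\<close> is invertible, it determines
      \<open>RUnit\<close>.\<close>
    by (rule exI[of _ Kl]) (use bicategory_Kl in \<open>auto simp: Kl_def inv_arr(2)[OF eta_iso]\<close>)
qed

end
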